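(* Every graph $G$ has slope-number $\operatorname{sn}(G)\leq\tfrac{1}{2}\operatorname{bw}(G)\,(\operatorname{bw}(G)+1)+1$.
   Context: A (straight-line) drawing of a graph maps its vertices to distinct points in the plane and represents each edge by the closed line segment between its endpoints, such that each edge segment intersects no vertex other than its own endpoints. The slope of an edge is the angle in $[0,\pi)$ from the $x$-axis to the line containing it. The slope-number $\operatorname{sn}(G)$ is the minimum number of distinct edge slopes over all drawings of $G$. The width of a vertex ordering $(v_1,\dots,v_n)$ of $G$ is $\max\{|i-j| : v_iv_j\in E(G)\}$; the bandwidth $\operatorname{bw}(G)$ is the minimum width of a vertex ordering of $G$. *)

theory Defs
  imports "HOL-Analysis.Analysis" "Graph_Theory.Digraph"
begin

text \<open>
  A graph is finite and simple, possibly null: the locale \<^locale>\<open>graph\<close>, in which an edge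
  \<open>uv\<close> is represented by the two adjacencies \<open>u \<rightarrow>\<^bsub>G\<^esub> v\<close> and \<open>v \<rightarrow>\<^bsub>G\<^esub> u\<close>.
  The plane is \<^typ>\<open>complex\<close>.
\<close>

definition is_drawing :: "('a, 'b) pre_digraph \<Rightarrow> ('a \<Rightarrow> complex) \<Rightarrow> bool" where
  "is_drawing G p \<longleftrightarrow>
     inj_on p (verts G) \<and>
     (\<forall>u v. u \<rightarrow>\<^bsub>G\<^esub> v \<longrightarrow>
        (\<forall>w\<in>verts G. p w \<in> closed_segment (p u) (p v) \<longrightarrow> w = u \<or> w = v))"

text \<open>
  Meaningful for \<open>x \<noteq> y\<close> only; the line through \<open>x\<close> and \<open>y\<close> makes angle \<open>\<theta>\<close> with the
  x-axis iff \<open>y - x\<close> is a (positive or negative) real multiple of \<open>cis \<theta>\<close>.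
\<close>
definition slope :: "complex \<Rightarrow> complex \<Rightarrow> real" where
  "slope x y = (THE \<theta>. 0 \<le> \<theta> \<and> \<theta> < pi \<and> (\<exists>r::real. y - x = of_real r * cis \<theta>))"

definition edge_slopes :: "('a, 'b) pre_digraph \<Rightarrow> ('a \<Rightarrow> complex) \<Rightarrow> real set" where
  "edge_slopes G p = {slope (p u) (p v) | u v. u \<rightarrow>\<^bsub>G\<^esub> v}"

definition slope_number :: "('a, 'b) pre_digraph \<Rightarrow> nat" where
  "slope_number G = (LEAST k. \<exists>p. is_drawing G p \<and> card (edge_slopes G p) = k)"

definition is_vertex_ordering :: "('a, 'b) pre_digraph \<Rightarrow> 'a list \<Rightarrow> bool" where
  "is_vertex_ordering G vs \<longleftrightarrow> distinct vs \<and> set vs = verts G"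

text \<open>The inserted 0 makes the width of an ordering of an edgeless graph 0.\<close>
definition ordering_width :: "('a, 'b) pre_digraph \<Rightarrow> 'a list \<Rightarrow> nat" where
  "ordering_width G vs =
     Max (insert 0 {nat \<bar>int i - int j\<bar> | i j.
       i < length vs \<and> j < length vs \<and> vs ! i \<rightarrow>\<^bsub>G\<^esub> vs ! j})"

definition bandwidth :: "('a, 'b) pre_digraph \<Rightarrow> nat" where
  "bandwidth G = (LEAST k. \<exists>vs. is_vertex_ordering G vs \<and> ordering_width G vs = k)"

text \<open>
  The definite description and both minima above are well defined.
\<close>

lemma slope_ex1:
  assumes "x \<noteq> y"
  shows "\<exists>!\<theta>. 0 \<le> \<theta> \<and> \<theta> < pi \<and> (\<exists>r::real. y - x = of_real r * cis \<theta>)"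
proof -
  define z where "z = y - x"
  have z: "z \<noteq> 0" using assms by (simp add: z_def)
  have rep: "z = of_real (norm z) * cis (Arg z)"
    using z by (metis rcis_cmod_Arg rcis_def)
  have ex: "\<exists>\<theta>. 0 \<le> \<theta> \<and> \<theta> < pi \<and> (\<exists>r::real. z = of_real r * cis \<theta>)"
  proof (cases "0 \<le> Arg z \<and> Arg z < pi")
    case True
    then show ?thesis using rep by blast
  next
    case False
    show ?thesis
    proof (cases "Arg z < 0")
      case True
      have "z = of_real (- norm z) * cis (Arg z + pi)"
        using rep by (simp add: cis_mult [symmetric])
      moreover have "0 \<le> Arg z + pi" "Arg z + pi < pi"
        using True Arg_bounded[of z] by auto
      ultimately show ?thesis by blast
    next
      case nonneg: False
      have "Arg z = pi" using False nonneg Arg_bounded[of z] by auto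
      then have "z = of_real (- norm z) * cis 0" using rep by simp
      then show ?thesis by (metis order_refl pi_gt_zero)
    qed
  qed
  have uniq: "\<theta> = \<phi>"
    if "0 \<le> \<theta>" "\<theta> < pi" "z = of_real r * cis \<theta>"
       "0 \<le> \<phi>" "\<phi> < pi" "z = of_real s * cis \<phi>" for \<theta> \<phi> r s :: real
  proof -
    have r: "r \<noteq> 0" using that(3) z by auto
    have eq: "of_real r * cis \<theta> = of_real s * cis \<phi>" using that by simp
    have "of_real r * cis (\<theta> - \<phi>) = of_real r * cis \<theta> * cis (- \<phi>)"
      by (simp add: cis_mult mult.assoc)
    also have "\<dots> = of_real s * (cis \<phi> * cis (- \<phi>))"
      by (simp only: eq mult.assoc)
    also have "\<dots> = of_real s" by (simp add: cis_mult)
    finally have "of_real r * cis (\<theta> - \<phi>) = of_real s" .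
    then have "Im (of_real r * cis (\<theta> - \<phi>)) = Im (of_real s)" by (rule arg_cong)
    then have "sin (\<theta> - \<phi>) = 0" using r by simp
    then show ?thesis
      using that sin_eq_0_pi[of "\<theta> - \<phi>"] by auto
  qed
  show ?thesis using ex uniq unfolding z_def by blast
qed

lemma drawing_exists:
  fixes G :: "('a, 'b) pre_digraph"
  assumes "graph G"
  shows "\<exists>p. is_drawing G p"
proof -
  interpret graph G by fact
  obtain f :: "'a \<Rightarrow> nat" and n where "f ` verts G = {i. i < n}" and f: "inj_on f (verts G)"
    using finite_imp_inj_to_nat_seg[OF finite_verts] by (elim exE conjE)
  define p where "p = (\<lambda>v. Complex (real (f v)) ((real (f v))\<^sup>2))"
  have inj: "inj_on p (verts G)"
    using f by (auto simp: p_def inj_on_def)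
  have "w = u \<or> w = v"
    if uv: "u \<rightarrow>\<^bsub>G\<^esub> v" and w: "w \<in> verts G" and seg: "p w \<in> closed_segment (p u) (p v)" for u v w
  proof -
    define a b c where "a = real (f u)" and "b = real (f v)" and "c = real (f w)"
    obtain t where "0 \<le> t" "t \<le> 1" and t: "p w = (1 - t) *\<^sub>R p u + t *\<^sub>R p v"
      using seg by (auto simp: closed_segment_def)
    have c1: "c = (1 - t) * a + t * b" and c2: "c\<^sup>2 = (1 - t) * a\<^sup>2 + t * b\<^sup>2"
      using arg_cong[OF t, of Re] arg_cong[OF t, of Im] by (simp_all add: p_def a_def b_def c_def)
    have "(c - a) * (c - b) = c\<^sup>2 - c * (a + b) + a * b"
      by (simp add: algebra_simps power2_eq_square)
    also have "\<dots> = 0"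
      unfolding c2 unfolding c1 by (simp add: algebra_simps power2_eq_square)
    finally have "f w = f u \<or> f w = f v"
      by (auto simp: a_def b_def c_def)
    moreover have "u \<in> verts G" "v \<in> verts G" using uv adj_in_verts by auto
    ultimately show ?thesis using f w by (auto dest: inj_onD)
  qed
  then show ?thesis using inj unfolding is_drawing_def by blast
qed

lemma slope_number_attained:
  assumes "graph G"
  shows "\<exists>p. is_drawing G p \<and> card (edge_slopes G p) = slope_number G"
  unfolding slope_number_def by (rule LeastI_ex) (use drawing_exists[OF assms] in blast)

lemma finite_edge_slopes:
  assumes "graph G"
  shows "finite (edge_slopes G p)"
proof -
  interpret graph G by fact
  have "edge_slopes G p = (\<lambda>(u, v). slope (p u) (p v)) ` arcs_ends G"
    by (force simp: edge_slopes_def)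
  then show ?thesis by (simp add: arcs_ends_def)
qed

lemma bandwidth_attained:
  assumes "graph G"
  shows "\<exists>vs. is_vertex_ordering G vs \<and> ordering_width G vs = bandwidth G"
proof -
  interpret graph G by fact
  have "\<exists>vs. is_vertex_ordering G vs"
    using finite_distinct_list[OF finite_verts] by (auto simp: is_vertex_ordering_def)
  then have "\<exists>k vs. is_vertex_ordering G vs \<and> ordering_width G vs = k" by blast
  then show ?thesis
    unfolding bandwidth_def by (rule LeastI_ex)
qed

end

theory Submission
  imports Defs
begin

text \<open>
  Let \<open>b\<close> be the bandwidth. Cut an optimal vertex ordering into blocks of \<open>b\<close> consecutive
  vertices, place the first block on the corners of a regular \<open>b\<close>-gon, and place every further
  block on a translate of it by a further copy of a long vector \<open>d\<close>. Chords of a regular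
  \<open>b\<close>-gon have only \<open>b\<close> slopes. Every other edge joins position \<open>i\<close> of a block to position
  \<open>j \<le> i\<close> of the next block; this gives the slope of \<open>d\<close> for \<open>i = j\<close> and at most
  \<open>b (b - 1) / 2\<close> further slopes. If no two corners lie on a line parallel to \<open>d\<close> and \<open>d\<close>
  is long enough, then no edge passes through a vertex.
\<close>

section \<open>Slopes and chords of the unit circle\<close>

text \<open>The predicates inside the two definite descriptions agree at every angle. A negative
  factor is harmless because a slope belongs to a line without direction.\<close>

lemma slope_eqI:
  assumes "c \<noteq> 0" and "y - x = of_real c * (y' - x')"
  shows "slope x y = slope x' y'"
proof -
  have "(\<exists>r::real. y - x = of_real r * cis \<theta>) \<longleftrightarrow> (\<exists>r::real. y' - x' = of_real r * cis \<theta>)" for \<theta>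
  proof
    assume "\<exists>r::real. y - x = of_real r * cis \<theta>"
    then obtain r where "of_real c * (y' - x') = of_real r * cis \<theta>"
      using assms by auto
    then have "y' - x' = of_real (r / c) * cis \<theta>"
      using assms(1) by (simp add: field_simps)
    then show "\<exists>r::real. y' - x' = of_real r * cis \<theta>" by blast
  next
    assume "\<exists>r::real. y' - x' = of_real r * cis \<theta>"
    then obtain r where "y' - x' = of_real r * cis \<theta>" by blast
    then have "y - x = of_real (c * r) * cis \<theta>"
      using assms(2) by simp
    then show "\<exists>r::real. y - x = of_real r * cis \<theta>" by blast
  qed
  then show ?thesis unfolding slope_def by simp
qed

lemma slope_commute: "slope x y = slope y x"
  by (rule slope_eqI[of "-1"]) auto

text \<open>Up to a real factor, the direction of a chord of the unit circle depends only on the sum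
  of the two angles. This is why a regular polygon has so few chord slopes.\<close>

lemma cis_diff_eq:
  "cis y - cis x = of_real (2 * sin ((y - x) / 2)) * (\<i> * cis ((x + y) / 2))"
  by (simp add: complex_eq_iff cos_diff_cos sin_diff_sin add.commute)
     (metis minus_diff_eq minus_divide_left mult_minus_left sin_minus)

text \<open>Strict convexity of the disc: an inner point of a segment is strictly closer to the
  centre than one of the ends.\<close>

lemma unit_sphere_closed_segment:
  fixes x y z :: complex
  assumes "norm x = 1" "norm y = 1" "norm z = 1" "z \<in> closed_segment x y"
  shows "z = x \<or> z = y"
proof (rule ccontr)
  assume "\<not> ?thesis"
  then have "z \<in> open_segment x y"
    using assms(4) by (simp add: open_segment_def)
  then have "dist 0 z < dist 0 x \<or> dist 0 z < dist 0 y"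
    by (rule dist_decreases_open_segment[rule_format])
  then show False using assms by (simp add: dist_norm)
qed

section \<open>The regular polygon and its chord slopes\<close>

text \<open>
  The rotation by \<open>\<pi> / (2 b)\<close> makes the real parts of the corners pairwise distinct.
\<close>
definition corner :: "nat \<Rightarrow> nat \<Rightarrow> complex" where
  "corner b i = cis (real (4 * i + 1) * pi / real (2 * b))"

lemma norm_corner [simp]: "norm (corner b i) = 1"
  by (simp add: corner_def)

text \<open>Blocks are stacked vertically, so this says that no two corners lie on a line parallel
  to the stacking direction. The difference of two cosines factors into sines of the half sum and
  the half difference of the angles.\<close>

lemma inj_on_Re_corner: "inj_on (\<lambda>i. Re (corner b i)) {..<b}"
proof (rule inj_onI)
  fix i j assume ij: "i \<in> {..<b}" "j \<in> {..<b}" and eq: "Re (corner b i) = Re (corner b j)"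
  then have b: "b > 0" by auto
  define x y where "x = real (4 * i + 1) * pi / real (2 * b)"
    and "y = real (4 * j + 1) * pi / real (2 * b)"
  have "cos x - cos y = 0" using eq by (simp add: corner_def x_def y_def)
  then consider "sin ((x + y) / 2) = 0" | "sin ((y - x) / 2) = 0"
    by (auto simp: cos_diff_cos)
  then show "i = j"
  proof cases
    \<comment> \<open>The half sum is an odd multiple of \<open>\<pi> / (2 * b)\<close>, hence never
      an integer multiple of \<pi>. This is what the rotation achieves.\<close>
    case 1
    then obtain k :: int where k: "(x + y) / 2 = of_int k * pi"
      by (auto simp: sin_zero_iff_int2)
    have "(x + y) / 2 = real (2 * (i + j) + 1) / real (2 * b) * pi"
      using b by (simp add: x_def y_def field_simps)
    then have "real (2 * (i + j) + 1) / real (2 * b) = of_int k"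
      using k by (metis mult_right_cancel pi_neq_zero)
    then have "real (2 * (i + j) + 1) = of_int k * real (2 * b)"
      using b by (simp add: field_simps)
    then have "of_int (int (2 * (i + j) + 1)) = (of_int (k * int (2 * b)) :: real)" by simp
    then have "int (2 * (i + j) + 1) = k * int (2 * b)" by (simp only: of_int_eq_iff)
    then have "even (int (2 * (i + j) + 1))" by simp
    then show ?thesis by simp
  next
    case 2
    then obtain k :: int where k: "(y - x) / 2 = of_int k * pi"
      by (auto simp: sin_zero_iff_int2)
    have "(y - x) / 2 = (real j - real i) / real b * pi"
      using b by (simp add: x_def y_def field_simps)
    then have "(real j - real i) / real b = of_int k"
      using k by (metis mult_right_cancel pi_neq_zero)
    then have "real j - real i = of_int k * real b"
      using b by (simp add: field_simps)
    then have "of_int (int j - int i) = (of_int (k * int b) :: real)" by simp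
    then have *: "int j - int i = k * int b" by (simp only: of_int_eq_iff)
    then have "int j mod int b = int i mod int b"
      by (metis mod_mult_self2 mult.commute diff_add_cancel add.commute)
    then show ?thesis using ij by simp
  qed
qed

text \<open>The angle is the mean of the angles of two corners whose indices sum to
  \<open>s\<close>; their chord is perpendicular to it.\<close>

definition chord_slopes :: "nat \<Rightarrow> real set" where
  "chord_slopes b = (\<lambda>s. slope 0 (\<i> * cis (real (2 * s + 1) * pi / real (2 * b)))) ` {..<b}"

text \<open>By \<open>cis_diff_eq\<close> only \<open>i + j\<close> matters for the direction.
  Lowering \<open>i + j\<close> by \<open>b\<close> turns the direction by \<pi>, which keeps the
  line, so only the residue modulo \<open>b\<close> counts.\<close>

lemma slope_corner:
  assumes "i < b" "j < b" "i \<noteq> j"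
  shows "slope (z + corner b i) (z + corner b j) \<in> chord_slopes b"
proof -
  have b: "b > 0" using assms by simp
  define \<theta> where "\<theta> s = real (2 * s + 1) * pi / real (2 * b)" for s
  define x y where "x = real (4 * i + 1) * pi / real (2 * b)"
    and "y = real (4 * j + 1) * pi / real (2 * b)"
  define c where "c = 2 * sin ((y - x) / 2)"
  have "(x + y) / 2 = \<theta> (i + j)"
    using b by (simp add: x_def y_def \<theta>_def field_simps)
  then have diff: "corner b j - corner b i = of_real c * (\<i> * cis (\<theta> (i + j)))"
    using cis_diff_eq[of y x] by (simp add: corner_def x_def y_def c_def)
  have c: "c \<noteq> 0"
  proof
    assume "c = 0"
    then have "Re (corner b i) = Re (corner b j)" using diff by simp
    then show False using inj_onD[OF inj_on_Re_corner, of b i j] assms by simp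
  qed
  have "\<exists>e\<in>{1, -1::real}. cis (\<theta> (i + j)) = of_real e * cis (\<theta> ((i + j) mod b))"
  proof (cases "i + j < b")
    case False
    then have "(i + j) mod b = i + j - b"
      using assms by (simp add: le_mod_geq)
    then have "i + j = (i + j) mod b + b" using False by simp
    then have "\<theta> (i + j) = \<theta> ((i + j) mod b + b)" by simp
    also have "\<dots> = \<theta> ((i + j) mod b) + pi"
      using b unfolding \<theta>_def by (simp add: field_simps)
    finally show ?thesis by (simp flip: cis_mult)
  qed simp
  then obtain e where "e \<noteq> 0" and e: "cis (\<theta> (i + j)) = of_real e * cis (\<theta> ((i + j) mod b))"
    by (metis insert_iff empty_iff neg_equal_0_iff_equal zero_neq_one)
  have "slope (z + corner b i) (z + corner b j) = slope 0 (\<i> * cis (\<theta> ((i + j) mod b)))"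
    by (rule slope_eqI[of "c * e"]) (use c \<open>e \<noteq> 0\<close> diff e in auto)
  then show ?thesis
    using b by (auto simp: chord_slopes_def \<theta>_def)
qed

section \<open>The stacked polygons and their slopes\<close>

text \<open>Here \<open>n\<close> is a position in the vertex ordering: \<open>n div b\<close> is
  its block and \<open>n mod b\<close> its place in the block. The translation vector is vertical,
  of length \<open>R\<close>.\<close>

definition stacked :: "nat \<Rightarrow> real \<Rightarrow> nat \<Rightarrow> complex" where
  "stacked b R n = corner b (n mod b) + \<i> * of_real (real (n div b) * R)"

lemma inj_stacked:
  assumes "b > 0" "R > 0"
  shows "inj (stacked b R)"
proof (rule injI)
  fix m n assume eq: "stacked b R m = stacked b R n"
  then have "Re (stacked b R m) = Re (stacked b R n)" by simp
  then have "m mod b = n mod b"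
    using inj_on_Re_corner[of b] assms by (auto simp: stacked_def dest: inj_onD)
  moreover from this have "m div b = n div b"
    using eq assms by (simp add: stacked_def)
  ultimately show "m = n" by (metis div_mult_mod_eq)
qed

text \<open>A step of at most \<open>b\<close> positions enters at most the next block, and there it
  cannot pass the place it started from.\<close>

lemma block_cases:
  fixes m n b :: nat
  assumes "m < n" "n \<le> m + b"
  obtains (same) "n div b = m div b" "m mod b \<noteq> n mod b"
    | (next_block) "n div b = Suc (m div b)" "n mod b \<le> m mod b"
proof -
  have b: "b > 0" using assms by simp
  have "n div b \<le> (m + b) div b" using assms(2) by (rule div_le_mono)
  then have "n div b \<le> Suc (m div b)" using b by simp
  moreover have "m div b \<le> n div b" using assms(1) by (simp add: div_le_mono)
  ultimately consider "n div b = m div b" | "n div b = Suc (m div b)" by linarith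
  then show thesis
  proof cases
    case 1
    then show ?thesis using assms(1) same by (metis div_mult_mod_eq less_irrefl)
  next
    case 2
    have "n div b * b + n mod b \<le> m div b * b + m mod b + b"
      using assms(2) by simp
    then have "n mod b \<le> m mod b"
      unfolding 2 mult_Suc by linarith
    then show ?thesis using 2 next_block by simp
  qed
qed

text \<open>Equal places are left out: all edges between them share the vertical slope, which is
  counted once, separately.\<close>

definition cross_slopes :: "nat \<Rightarrow> real \<Rightarrow> real set" where
  "cross_slopes b R =
     (\<lambda>(i, j). slope 0 (corner b j - corner b i + \<i> * of_real R)) ` (SIGMA i:{..<b}. {..<i})"

text \<open>Consecutive blocks always differ by the same translation, so the slope of an edge
  between them depends only on its two places.\<close>

lemma slope_stacked:
  assumes "m < n" "n \<le> m + b"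
  shows "slope (stacked b R m) (stacked b R n)
    \<in> insert (slope 0 (\<i> * of_real R)) (chord_slopes b \<union> cross_slopes b R)"
  using assms
proof (cases rule: block_cases)
  case same
  then show ?thesis
    using slope_corner[of "m mod b" b "n mod b" "\<i> * of_real (real (m div b) * R)"] assms
    by (simp add: stacked_def add.commute)
next
  case next_block
  have *: "slope (stacked b R m) (stacked b R n)
      = slope 0 (corner b (n mod b) - corner b (m mod b) + \<i> * of_real R)"
    by (rule slope_eqI[of 1]) (use next_block in \<open>auto simp: stacked_def algebra_simps\<close>)
  show ?thesis
  proof (cases "m mod b = n mod b")
    case False
    then have "(m mod b, n mod b) \<in> (SIGMA i:{..<b}. {..<i})"
      using next_block assms by simp
    then show ?thesis unfolding * cross_slopes_def by force
  qed (simp add: *)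
qed

text \<open>The count is 1 for \<open>c\<close>, at most \<open>b\<close> for the chords and at most
  \<open>b * (b - 1) / 2\<close> for the pairs of places.\<close>

lemma card_stacked_slopes:
  "real (card (insert c (chord_slopes b \<union> cross_slopes b R)))
    \<le> 1 / 2 * real b * (real b + 1) + 1"
proof -
  have "card (chord_slopes b) \<le> b"
    unfolding chord_slopes_def by (metis card_image_le card_lessThan finite_lessThan)
  moreover have "card (cross_slopes b R) \<le> (\<Sum>i<b. i)"
    unfolding cross_slopes_def
    by (rule order_trans[OF card_image_le]) simp_all
  moreover have "card (insert c (chord_slopes b \<union> cross_slopes b R))
      \<le> Suc (card (chord_slopes b) + card (cross_slopes b R))"
    using card_Un_le[of "chord_slopes b" "cross_slopes b R"]
    by (simp add: card_insert_if chord_slopes_def cross_slopes_def)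
  moreover have "real (\<Sum>i<b. i) = real b * (real b - 1) / 2"
    by (induction b) (auto simp: field_simps)
  ultimately have "real (card (insert c (chord_slopes b \<union> cross_slopes b R)))
      \<le> 1 + real b + real b * (real b - 1) / 2"
    by linarith
  then show ?thesis by (simp add: field_simps)
qed

section \<open>No edge passes through another vertex\<close>

text \<open>Turns the distinctness of the real parts of the corners into one uniform gap, from which
  \<open>R\<close> is chosen.\<close>

lemma finite_separation:
  fixes f :: "'a \<Rightarrow> real"
  assumes "finite A" "inj_on f A"
  obtains \<delta> where "\<delta> > 0" "\<And>x y. x \<in> A \<Longrightarrow> y \<in> A \<Longrightarrow> x \<noteq> y \<Longrightarrow> \<delta> \<le> \<bar>f x - f y\<bar>"
proof -
  \<comment> \<open>The element 1 keeps the minimum defined when \<open>A\<close> has fewer than two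
    elements, as happens for a single corner.\<close>
  define D where "D = insert 1 ((\<lambda>(x, y). \<bar>f x - f y\<bar>) ` {(x, y) \<in> A \<times> A. x \<noteq> y})"
  have "finite {(x, y) \<in> A \<times> A. x \<noteq> y}"
    by (rule finite_subset[of _ "A \<times> A"]) (use assms in auto)
  then have fin: "finite D" by (simp add: D_def)
  show thesis
  proof (rule that[of "Min D"])
    show "Min D > 0"
      using fin assms(2) by (subst Min_gr_iff) (auto simp: D_def dest: inj_onD)
    show "Min D \<le> \<bar>f x - f y\<bar>" if "x \<in> A" "y \<in> A" "x \<noteq> y" for x y
      using fin that by (intro Min_le) (auto simp: D_def)
  qed
qed

text \<open>
  Moving sideways by \<open>\<delta>\<close> takes a parameter \<open>t \<ge> \<delta> / 2\<close>, at which a segment of height about \<open>R\<close>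
  has already left the block.
\<close>
lemma steep_segment_avoids:
  fixes x1 x2 x3 y1 y2 y3 t \<delta> R :: real
  assumes "\<bar>x1\<bar> \<le> 1" "\<bar>x2\<bar> \<le> 1" "\<bar>y1\<bar> \<le> 1" "\<bar>y2\<bar> \<le> 1" "\<bar>y3\<bar> \<le> 1"
    and \<delta>: "\<delta> > 0" "\<delta> \<le> \<bar>x3 - x1\<bar>" and R: "R > 2 + 4 / \<delta>" and t: "0 \<le> t"
    and x3: "x3 = (1 - t) * x1 + t * x2" and y3: "y3 = (1 - t) * y1 + t * (y2 + R)"
  shows False
proof -
  have "x3 - x1 = t * (x2 - x1)" using x3 by (simp add: algebra_simps)
  then have "\<bar>x3 - x1\<bar> = t * \<bar>x2 - x1\<bar>" using t by (simp add: abs_mult)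
  also have "\<dots> \<le> t * 2" by (intro mult_left_mono t) (use assms in linarith)
  finally have "\<delta> / 2 \<le> t" using \<delta> by simp
  have R2: "R - 2 > 4 / \<delta>" using R by simp
  \<comment> \<open>Two heights within one block differ by at most 2; the summand
    \<open>4 / \<delta>\<close> makes the rise exceed this.\<close>
  have "2 = \<delta> / 2 * (4 / \<delta>)" using \<delta> by simp
  also have "\<dots> < \<delta> / 2 * (R - 2)" using R2 \<delta> by (intro mult_strict_left_mono) auto
  also have "\<dots> \<le> t * (R - 2)"
  proof (rule mult_right_mono)
    show "0 \<le> R - 2" using R2 \<delta> by (smt (verit) divide_pos_pos)
  qed fact
  also have "\<dots> \<le> t * (y2 - y1 + R)" by (intro mult_left_mono t) (use assms in linarith)
  also have "\<dots> = y3 - y1" using y3 by (simp add: algebra_simps)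
  finally show False using assms by linarith
qed

text \<open>Comparing heights confines \<open>r\<close> to the blocks of \<open>m\<close> and
  \<open>n\<close>. Inside one block strict convexity of the disc finishes; between two blocks the
  segment is too steep to meet another corner.\<close>

lemma stacked_avoids:
  assumes \<delta>: "\<delta> > 0"
      "\<And>i j. i < b \<Longrightarrow> j < b \<Longrightarrow> i \<noteq> j \<Longrightarrow> \<delta> \<le> \<bar>Re (corner b i) - Re (corner b j)\<bar>"
    and R: "R > 2 + 4 / \<delta>"
    and mn: "m < n" "n \<le> m + b"
    and r: "stacked b R r \<in> closed_segment (stacked b R m) (stacked b R n)"
  shows "r = m \<or> r = n"
proof -
  have b: "b > 0" using mn by simp
  have R2: "R > 2" using R \<delta>(1) by (smt (verit) divide_pos_pos)
  define i j l where "i = m mod b" and "j = n mod b" and "l = r mod b"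
  have ijl: "i < b" "j < b" "l < b" using b by (auto simp: i_def j_def l_def)
  define x y where "x i = Re (corner b i)" and "y i = Im (corner b i)" for i
  have xy: "\<bar>x i\<bar> \<le> 1" "\<bar>y i\<bar> \<le> 1" for i
    using abs_Re_le_cmod[of "corner b i"] abs_Im_le_cmod[of "corner b i"]
    by (auto simp: x_def y_def)
  obtain t where t: "0 \<le> t" "t \<le> 1"
    and st: "stacked b R r = (1 - t) *\<^sub>R stacked b R m + t *\<^sub>R stacked b R n"
    using r by (auto simp: closed_segment_def)
  have re: "x l = (1 - t) * x i + t * x j"
    using arg_cong[OF st, of Re] by (simp add: stacked_def x_def i_def j_def l_def)
  \<comment> \<open>Block offsets of \<open>r\<close> and \<open>n\<close> from the block of
    \<open>m\<close>.\<close>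
  define g h where "g = real (r div b) - real (m div b)" and "h = real (n div b) - real (m div b)"
  have im: "y l + g * R = (1 - t) * y i + t * (y j + h * R)"
    using arg_cong[OF st, of Im]
    by (simp add: stacked_def y_def i_def j_def l_def g_def h_def algebra_simps)
  have avg: "\<bar>(1 - t) * y i + t * y j\<bar> \<le> 1"
  proof -
    have "\<bar>(1 - t) * y i + t * y j\<bar> \<le> (1 - t) * \<bar>y i\<bar> + t * \<bar>y j\<bar>"
      using t by (intro order_trans[OF abs_triangle_ineq]) (simp add: abs_mult)
    also have "\<dots> \<le> 1" using t xy by (intro convex_bound_le) auto
    finally show ?thesis .
  qed
  \<comment> \<open>Apart from the block offsets, the heights on both sides differ by at most 2,
    which is less than \<open>R\<close>. As \<open>g\<close> is an integer, few blocks remain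
    possible.\<close>
  have bound: "\<bar>g - t * h\<bar> < 1"
  proof -
    have "(g - t * h) * R = (1 - t) * y i + t * y j - y l"
      using im by (simp add: algebra_simps)
    then have "\<bar>(g - t * h) * R\<bar> \<le> 2"
      using avg xy(2)[of l] by linarith
    then have "\<bar>g - t * h\<bar> * R \<le> 2"
      using R2 by (simp add: abs_mult)
    then have "\<bar>g - t * h\<bar> * R < 1 * R" using R2 by linarith
    then show ?thesis using R2 by (subst (asm) mult_less_cancel_right) auto
  qed
  from mn show ?thesis
  proof (cases rule: block_cases)
    case same
    then have h: "h = 0" by (simp add: h_def)
    then have "real (r div b) < real (m div b + 1)" "real (m div b) < real (r div b + 1)"
      using bound by (auto simp: g_def)
    then have div: "r div b = m div b" by linarith
    have "corner b l = (1 - t) *\<^sub>R corner b i + t *\<^sub>R corner b j"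
      using re im div h by (simp add: complex_eq_iff x_def y_def g_def)
    then have "corner b l \<in> closed_segment (corner b i) (corner b j)"
      using t by (auto simp: closed_segment_def)
    then have "corner b l = corner b i \<or> corner b l = corner b j"
      by (intro unit_sphere_closed_segment) auto
    then have "l = i \<or> l = j"
      using inj_on_Re_corner[of b] ijl by (metis inj_onD lessThan_iff)
    then show ?thesis
      using div same(1) by (metis div_mult_mod_eq i_def j_def l_def)
  next
    case next_block
    then have h: "h = 1" by (simp add: h_def)
    then have "real (m div b) < real (r div b + 1)" "real (r div b) < real (m div b + 2)"
      using bound t by (auto simp: g_def)
    then consider "r div b = m div b" | "r div b = Suc (m div b)" by linarith
    then show ?thesis
    proof cases
      case 1
      have "l = i"
      proof (rule ccontr)
        assume "l \<noteq> i"
        then have sep: "\<delta> \<le> \<bar>x l - x i\<bar>" using \<delta>(2) ijl by (simp add: x_def)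
        have "y l = (1 - t) * y i + t * (y j + R)" using im h 1 by (simp add: g_def)
        from steep_segment_avoids[OF xy(1) xy(1) xy(2) xy(2) xy(2) \<delta>(1) sep R t(1) re this]
        show False .
      qed
      then show ?thesis using 1 by (metis div_mult_mod_eq i_def l_def)
    next
      case 2
      have "l = j"
      proof (rule ccontr)
        assume "l \<noteq> j"
        then have sep: "\<delta> \<le> \<bar>x l - x j\<bar>" using \<delta>(2) ijl by (simp add: x_def)
        have neg: "\<bar>- y i\<bar> \<le> 1" for i using xy(2) by simp
        \<comment> \<open>For a vertex in the upper block, read the segment from its upper end and
          reflect heights, so that it rises again and \<open>1 - t\<close> is the parameter.\<close>
        have "x l = (1 - (1 - t)) * x j + (1 - t) * x i"
          using re by simp
        moreover have "- y l = (1 - (1 - t)) * (- y j) + (1 - t) * (- y i + R)"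
          using im h 2 by (simp add: g_def algebra_simps)
        moreover have "0 \<le> 1 - t" using t by simp
        ultimately show False
          using steep_segment_avoids[OF xy(1) xy(1) neg neg neg \<delta>(1) sep R] by blast
      qed
      then show ?thesis using 2 next_block(1) by (metis div_mult_mod_eq j_def l_def)
    qed
  qed
qed

section \<open>From an optimal ordering to the drawing\<close>

text \<open>Replaces the ordering by the position function. The two inequalities bound the distance
  without subtraction on naturals, as \<open>block_cases\<close> expects.\<close>

lemma bandwidth_labelling:
  assumes "graph G"
  obtains f :: "'a \<Rightarrow> nat" where "inj_on f (verts G)"
    "\<And>u v. u \<rightarrow>\<^bsub>G\<^esub> v \<Longrightarrow> f u \<noteq> f v \<and> f u \<le> f v + bandwidth G \<and> f v \<le> f u + bandwidth G"
proof -
  interpret graph G by fact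
  obtain vs where vs: "distinct vs" "set vs = verts G" and width: "ordering_width G vs = bandwidth G"
    using bandwidth_attained[OF assms] by (auto simp: is_vertex_ordering_def)
  define f where "f = inv_into {..<length vs} ((!) vs)"
  have img: "(!) vs ` {..<length vs} = verts G"
    using vs(2) by (auto simp: set_conv_nth)
  have f: "f v < length vs" "vs ! f v = v" if "v \<in> verts G" for v
    using that img inv_into_into[of v "(!) vs" "{..<length vs}"]
      f_inv_into_f[of v "(!) vs" "{..<length vs}"] by (auto simp: f_def)
  define D where "D = {nat \<bar>int i - int j\<bar> | i j.
       i < length vs \<and> j < length vs \<and> vs ! i \<rightarrow>\<^bsub>G\<^esub> vs ! j}"
  have "D \<subseteq> (\<lambda>(i, j). nat \<bar>int i - int j\<bar>) ` ({..<length vs} \<times> {..<length vs})"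
    by (auto simp: D_def)
  then have fin: "finite D" by (rule finite_subset) simp
  show thesis
  proof (rule that)
    show inj: "inj_on f (verts G)" by (metis f(2) inj_onI)
    fix u v assume uv: "u \<rightarrow>\<^bsub>G\<^esub> v"
    then have in_verts: "u \<in> verts G" "v \<in> verts G" using adj_in_verts by auto
    then have "nat \<bar>int (f u) - int (f v)\<bar> \<in> insert 0 D"
      using f uv unfolding D_def by (intro insertI2 CollectI exI[of _ "f u"] exI[of _ "f v"]) simp
    then have "nat \<bar>int (f u) - int (f v)\<bar> \<le> bandwidth G"
      using fin by (simp add: Max_ge flip: width D_def add: ordering_width_def)
    moreover have "f u \<noteq> f v"
      using inj in_verts uv adj_not_same by (metis inj_onD)
    ultimately show "f u \<noteq> f v \<and> f u \<le> f v + bandwidth G \<and> f v \<le> f u + bandwidth G" by linarith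
  qed
qed

lemma slope_number_le:
  assumes "is_drawing G p"
  shows "slope_number G \<le> card (edge_slopes G p)"
  unfolding slope_number_def using assms by (intro Least_le) blast

theorem theorem4:
  fixes G :: "('a, 'b) pre_digraph"
  assumes "graph G"
  shows "real (slope_number G) \<le> 1 / 2 * real (bandwidth G) * (real (bandwidth G) + 1) + 1"
proof -
  interpret graph G by fact
  define b where "b = bandwidth G"
  obtain f where inj: "inj_on f (verts G)"
    and f: "\<And>u v. u \<rightarrow>\<^bsub>G\<^esub> v \<Longrightarrow> f u \<noteq> f v \<and> f u \<le> f v + b \<and> f v \<le> f u + b"
    using bandwidth_labelling[OF assms] unfolding b_def by blast
  show ?thesis
  proof (cases "b = 0")
    \<comment> \<open>Adjacent vertices would have equal and distinct positions, so there are no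
      edges and any drawing has no slopes. Blocks need \<open>b > 0\<close>.\<close>
    case True
    then have "\<not> u \<rightarrow>\<^bsub>G\<^esub> v" for u v using f[of u v] by auto
    moreover obtain p where "is_drawing G p" using drawing_exists[OF assms] by blast
    ultimately have "slope_number G \<le> 0"
      using slope_number_le[of G p] by (simp add: edge_slopes_def)
    then show ?thesis by simp
  next
    case False
    obtain \<delta> where \<delta>: "\<delta> > 0"
      "\<And>i j. i < b \<Longrightarrow> j < b \<Longrightarrow> i \<noteq> j \<Longrightarrow> \<delta> \<le> \<bar>Re (corner b i) - Re (corner b j)\<bar>"
      using finite_separation[OF _ inj_on_Re_corner, of b] by auto
    \<comment> \<open>The 3 makes the required inequality strict.\<close>
    define R where "R = 3 + 4 / \<delta>"
    have R: "R > 2 + 4 / \<delta>" "R > 0" using \<delta>(1) by (auto simp: R_def add_pos_pos)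
    define p where "p = stacked b R \<circ> f"
    have "is_drawing G p"
      unfolding is_drawing_def
    proof (intro conjI allI ballI impI)
      show "inj_on p (verts G)"
        unfolding p_def using inj inj_stacked[of b R] False R
        by (auto intro: comp_inj_on inj_on_subset)
      fix u v w
      assume uv: "u \<rightarrow>\<^bsub>G\<^esub> v" and w: "w \<in> verts G" and seg: "p w \<in> closed_segment (p u) (p v)"
      have "f w = f u \<or> f w = f v"
      proof (cases "f u < f v")
        case True
        then show ?thesis
          using stacked_avoids[OF \<delta> R(1), of "f u" "f v" "f w"] f[OF uv] seg
          by (simp add: p_def)
      next
        case False
        then show ?thesis
          using stacked_avoids[OF \<delta> R(1), of "f v" "f u" "f w"] f[OF uv] seg
          by (auto simp: p_def closed_segment_commute)
      qed
      then show "w = u \<or> w = v"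
        using inj w uv adj_in_verts by (auto dest: inj_onD)
    qed
    then have "slope_number G \<le> card (edge_slopes G p)" by (rule slope_number_le)
    moreover have "edge_slopes G p
        \<subseteq> insert (slope 0 (\<i> * of_real R)) (chord_slopes b \<union> cross_slopes b R)" (is "_ \<subseteq> ?S")
    proof -
      have "slope (p u) (p v) \<in> ?S" if uv: "u \<rightarrow>\<^bsub>G\<^esub> v" for u v
      proof (cases "f u < f v")
        case True
        then show ?thesis using slope_stacked[of "f u" "f v" b R] f[OF uv] by (simp add: p_def)
      next
        case False
        then have "slope (p v) (p u) \<in> ?S"
          using slope_stacked[of "f v" "f u" b R] f[OF uv] by (simp add: p_def)
        then show ?thesis by (subst slope_commute)
      qed
      then show ?thesis by (auto simp only: edge_slopes_def)
    qed
    moreover have "finite ?S" by (simp add: chord_slopes_def cross_slopes_def)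
    ultimately have "slope_number G \<le> card ?S" by (meson card_mono order_trans)
    then show ?thesis
      using card_stacked_slopes[of _ b R] unfolding b_def by (meson of_nat_mono order_trans)
  qed
qed

end
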